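(* If there exists a non-sofic group, then the class of $\omega$-non-sofic groups is non-empty.
   Context: For $n\ge 1$, the normalized Hamming metric on the symmetric group $S_n$ is $d_{\mathrm{hamm}}(\sigma,\tau)=\frac1n\#\{i:\sigma(i)\ne\tau(i)\}$. A group $G$ is sofic if there exist a set $A$, an ultrafilter $\mathcal U$ on $A$ and a map $\alpha\mapsto n(\alpha)$ from $A$ to the positive integers such that $G$ is isomorphic to a subgroup of the metric ultraproduct $\prod_{\alpha\in A}(S_{n(\alpha)},d_{\mathrm{hamm}})/\mathcal U$, i.e. the quotient of $\prod_{\alpha} S_{n(\alpha)}$ by the normal subgroup of all $(\sigma_\alpha)$ with $\lim_{\alpha\to\mathcal U} d_{\mathrm{hamm}}(\sigma_\alpha,\mathrm{Id})=0$. A non-sofic group is called $\omega$-non-sofic if it admits an infinite strictly descending chain $H_0>H_1>H_2>\cdots$ of non-sofic subgroups. *)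

theory Defs
  imports Complex_Main "HOL-Algebra.Sym_Groups" "HOL-Algebra.Product_Groups"
begin

section \<open>Ultrafilters and metric ultraproducts of symmetric groups\<close>

text \<open>
  An ultrafilter on a set \<open>A\<close> is represented by a filter on the ambient type that is
  concentrated on \<open>A\<close>. Principal ultrafilters are allowed.
\<close>
definition ultrafilter_on :: "'i set \<Rightarrow> 'i filter \<Rightarrow> bool" where
  "ultrafilter_on A U \<longleftrightarrow>
     U \<noteq> bot \<and> eventually (\<lambda>\<alpha>. \<alpha> \<in> A) U \<and>
     (\<forall>P. eventually P U \<or> eventually (\<lambda>\<alpha>. \<not> P \<alpha>) U)"

definition hamm_dist :: "nat \<Rightarrow> (nat \<Rightarrow> nat) \<Rightarrow> (nat \<Rightarrow> nat) \<Rightarrow> real" where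
  "hamm_dist n \<sigma> \<tau> = real (card {i \<in> {1..n}. \<sigma> i \<noteq> \<tau> i}) / real n"

definition hamm_product :: "'i set \<Rightarrow> ('i \<Rightarrow> nat) \<Rightarrow> ('i \<Rightarrow> nat \<Rightarrow> nat) monoid" where
  "hamm_product A n = product_group A (\<lambda>\<alpha>. sym_group (n \<alpha>))"

definition hamm_null :: "'i set \<Rightarrow> 'i filter \<Rightarrow> ('i \<Rightarrow> nat) \<Rightarrow> ('i \<Rightarrow> nat \<Rightarrow> nat) set" where
  "hamm_null A U n =
     {\<sigma> \<in> carrier (hamm_product A n). ((\<lambda>\<alpha>. hamm_dist (n \<alpha>) (\<sigma> \<alpha>) id) \<longlongrightarrow> 0) U}"

definition hamm_ultraproduct ::
    "'i set \<Rightarrow> 'i filter \<Rightarrow> ('i \<Rightarrow> nat) \<Rightarrow> ('i \<Rightarrow> nat \<Rightarrow> nat) set monoid" where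
  "hamm_ultraproduct A U n = hamm_product A n Mod hamm_null A U n"

definition embeds_in_hamm_ultraproduct ::
    "('g, 'b) monoid_scheme \<Rightarrow> 'i set \<Rightarrow> 'i filter \<Rightarrow> ('i \<Rightarrow> nat) \<Rightarrow> bool" where
  "embeds_in_hamm_ultraproduct G A U n \<longleftrightarrow>
     (\<exists>H. subgroup H (hamm_ultraproduct A U n) \<and>
          G \<cong> (hamm_ultraproduct A U n)\<lparr>carrier := H\<rparr>)"


section \<open>Sofic groups\<close>

text \<open>
  The definition of soficity quantifies over all index sets \<open>A\<close>. A HOL formula cannot
  quantify over types, so the index sets are taken inside the type of pairs of a set of
  group elements and a natural number. This is no restriction: \<open>soficI_any_index\<close> below
  shows that an embedding into an ultraproduct over an index set of an arbitrary type
  already yields one over an index set of this type.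
\<close>
definition sofic :: "('g, 'b) monoid_scheme \<Rightarrow> bool" where
  "sofic G \<longleftrightarrow> group G \<and>
     (\<exists>(A :: ('g set \<times> nat) set) U n.
        ultrafilter_on A U \<and> (\<forall>\<alpha>\<in>A. n \<alpha> \<ge> 1) \<and> embeds_in_hamm_ultraproduct G A U n)"

definition non_sofic :: "('g, 'b) monoid_scheme \<Rightarrow> bool" where
  "non_sofic G \<longleftrightarrow> group G \<and> \<not> sofic G"

definition omega_non_sofic :: "('g, 'b) monoid_scheme \<Rightarrow> bool" where
  "omega_non_sofic G \<longleftrightarrow> non_sofic G \<and>
     (\<exists>H :: nat \<Rightarrow> 'g set.
        (\<forall>i. subgroup (H i) G \<and> non_sofic (G\<lparr>carrier := H i\<rparr>)) \<and>
        (\<forall>i. H (Suc i) \<subset> H i))"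


section \<open>The Hamming metric is bi-invariant\<close>

lemma hamm_dist_nonneg: "0 \<le> hamm_dist n \<sigma> \<tau>"
  by (simp add: hamm_dist_def)

lemma hamm_dist_refl [simp]: "hamm_dist n \<sigma> \<sigma> = 0"
  by (simp add: hamm_dist_def)

lemma hamm_dist_commute: "hamm_dist n \<sigma> \<tau> = hamm_dist n \<tau> \<sigma>"
  unfolding hamm_dist_def by (metis (mono_tags, lifting))

lemma hamm_dist_triangle: "hamm_dist n \<sigma> \<tau> \<le> hamm_dist n \<sigma> \<rho> + hamm_dist n \<rho> \<tau>"
proof -
  have "card {i \<in> {1..n}. \<sigma> i \<noteq> \<tau> i}
      \<le> card ({i \<in> {1..n}. \<sigma> i \<noteq> \<rho> i} \<union> {i \<in> {1..n}. \<rho> i \<noteq> \<tau> i})"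
    by (rule card_mono) auto
  also have "\<dots> \<le> card {i \<in> {1..n}. \<sigma> i \<noteq> \<rho> i} + card {i \<in> {1..n}. \<rho> i \<noteq> \<tau> i}"
    by (rule card_Un_le)
  finally show ?thesis
    unfolding hamm_dist_def add_divide_distrib [symmetric]
    by (intro divide_right_mono) auto
qed

lemma hamm_dist_left:
  assumes "\<rho> permutes S"
  shows "hamm_dist n (\<rho> \<circ> \<sigma>) (\<rho> \<circ> \<tau>) = hamm_dist n \<sigma> \<tau>"
proof -
  have "\<rho> x = \<rho> y \<longleftrightarrow> x = y" for x y
    using permutes_inj [OF assms] by (auto simp: inj_def)
  then show ?thesis
    unfolding hamm_dist_def comp_apply by simp
qed

lemma hamm_dist_right:
  assumes "\<rho> permutes {1..n}"
  shows "hamm_dist n (\<sigma> \<circ> \<rho>) (\<tau> \<circ> \<rho>) = hamm_dist n \<sigma> \<tau>"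
proof -
  have "\<rho> ` {i \<in> {1..n}. \<sigma> (\<rho> i) \<noteq> \<tau> (\<rho> i)} = {i \<in> {1..n}. \<sigma> i \<noteq> \<tau> i}"
  proof safe
    fix i assume "i \<in> {1..n}" "\<sigma> i \<noteq> \<tau> i"
    moreover obtain j where "i = \<rho> j" "j \<in> {1..n}"
      using permutes_image [OF assms] \<open>i \<in> {1..n}\<close> by blast
    ultimately show "i \<in> \<rho> ` {i \<in> {1..n}. \<sigma> (\<rho> i) \<noteq> \<tau> (\<rho> i)}" by auto
  qed (use permutes_in_image [OF assms] in auto)
  moreover have "inj_on \<rho> {i \<in> {1..n}. \<sigma> (\<rho> i) \<noteq> \<tau> (\<rho> i)}"
    using permutes_inj [OF assms] by (rule inj_on_subset) simp
  ultimately have "card {i \<in> {1..n}. \<sigma> (\<rho> i) \<noteq> \<tau> (\<rho> i)} = card {i \<in> {1..n}. \<sigma> i \<noteq> \<tau> i}"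
    using card_image by fastforce
  then show ?thesis
    by (simp add: hamm_dist_def)
qed


section \<open>The null sequences form a normal subgroup\<close>

lemma hamm_product_group: "group (hamm_product A n)"
  by (simp add: hamm_product_def sym_group_is_group)

lemma hamm_product_carrier:
  "\<sigma> \<in> carrier (hamm_product A n) \<longleftrightarrow> \<sigma> \<in> extensional A \<and> (\<forall>\<alpha>\<in>A. \<sigma> \<alpha> permutes {1..n \<alpha>})"
  by (auto simp: hamm_product_def PiE_iff sym_group_carrier)

lemma hamm_product_permutes:
  "\<sigma> \<in> carrier (hamm_product A n) \<Longrightarrow> \<alpha> \<in> A \<Longrightarrow> \<sigma> \<alpha> permutes {1..n \<alpha>}"
  by (simp add: hamm_product_carrier)

lemma hamm_product_mult:
  "\<alpha> \<in> A \<Longrightarrow> (\<sigma> \<otimes>\<^bsub>hamm_product A n\<^esub> \<tau>) \<alpha> = \<sigma> \<alpha> \<circ> \<tau> \<alpha>"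
  by (simp add: hamm_product_def sym_group_mult)

lemma hamm_product_one: "\<alpha> \<in> A \<Longrightarrow> \<one>\<^bsub>hamm_product A n\<^esub> \<alpha> = id"
  by (simp add: hamm_product_def sym_group_one)

lemma hamm_product_inv:
  assumes "\<sigma> \<in> carrier (hamm_product A n)" "\<alpha> \<in> A"
  shows "\<sigma> \<alpha> \<circ> (inv\<^bsub>hamm_product A n\<^esub> \<sigma>) \<alpha> = id"
proof -
  have "(\<sigma> \<otimes>\<^bsub>hamm_product A n\<^esub> inv\<^bsub>hamm_product A n\<^esub> \<sigma>) \<alpha> = \<one>\<^bsub>hamm_product A n\<^esub> \<alpha>"
    by (simp only: group.r_inv [OF hamm_product_group assms(1)])
  then show ?thesis
    by (simp only: hamm_product_mult [OF assms(2)] hamm_product_one [OF assms(2)])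
qed

lemma hamm_tendsto_0_le:
  assumes "eventually (\<lambda>\<alpha>. \<alpha> \<in> A) U" "(f \<longlongrightarrow> (0 :: real)) U"
    and "\<And>\<alpha>. \<alpha> \<in> A \<Longrightarrow> hamm_dist (n \<alpha>) (\<sigma> \<alpha>) (\<tau> \<alpha>) \<le> f \<alpha>"
  shows "((\<lambda>\<alpha>. hamm_dist (n \<alpha>) (\<sigma> \<alpha>) (\<tau> \<alpha>)) \<longlongrightarrow> 0) U"
proof (rule tendsto_sandwich [OF _ _ tendsto_const assms(2)])
  show "eventually (\<lambda>\<alpha>. 0 \<le> hamm_dist (n \<alpha>) (\<sigma> \<alpha>) (\<tau> \<alpha>)) U"
    by (simp add: hamm_dist_nonneg)
  show "eventually (\<lambda>\<alpha>. hamm_dist (n \<alpha>) (\<sigma> \<alpha>) (\<tau> \<alpha>) \<le> f \<alpha>) U"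
    using assms(1) by (rule eventually_mono) (rule assms(3))
qed

lemma hamm_null_normal:
  assumes U: "eventually (\<lambda>\<alpha>. \<alpha> \<in> A) U"
  shows "hamm_null A U n \<lhd> hamm_product A n"
proof -
  interpret P: group "hamm_product A n" by (rule hamm_product_group)
  let ?N = "hamm_null A U n"
  have mult: "\<sigma> \<otimes>\<^bsub>hamm_product A n\<^esub> \<tau> \<in> ?N" if "\<sigma> \<in> ?N" "\<tau> \<in> ?N" for \<sigma> \<tau>
  proof -
    have c: "\<sigma> \<in> carrier (hamm_product A n)" "\<tau> \<in> carrier (hamm_product A n)"
      using that by (auto simp: hamm_null_def)
    have le: "hamm_dist (n \<alpha>) ((\<sigma> \<otimes>\<^bsub>hamm_product A n\<^esub> \<tau>) \<alpha>) id
        \<le> hamm_dist (n \<alpha>) (\<sigma> \<alpha>) id + hamm_dist (n \<alpha>) (\<tau> \<alpha>) id" if "\<alpha> \<in> A" for \<alpha>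
    proof -
      have "hamm_dist (n \<alpha>) (\<sigma> \<alpha> \<circ> \<tau> \<alpha>) (\<sigma> \<alpha> \<circ> id) = hamm_dist (n \<alpha>) (\<tau> \<alpha>) id"
        by (rule hamm_dist_left [OF hamm_product_permutes [OF c(1) that]])
      then show ?thesis
        using hamm_dist_triangle [of "n \<alpha>" "\<sigma> \<alpha> \<circ> \<tau> \<alpha>" id "\<sigma> \<alpha>"] that
        by (simp add: hamm_product_mult)
    qed
    have "((\<lambda>\<alpha>. hamm_dist (n \<alpha>) (\<sigma> \<alpha>) id + hamm_dist (n \<alpha>) (\<tau> \<alpha>) id) \<longlongrightarrow> 0) U"
      using that by (intro tendsto_add_zero) (auto simp: hamm_null_def)
    from hamm_tendsto_0_le [where \<tau> = "\<lambda>_. id", OF U this le]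
    show ?thesis using c by (simp add: hamm_null_def)
  qed
  have inv: "inv\<^bsub>hamm_product A n\<^esub> \<sigma> \<in> ?N" if "\<sigma> \<in> ?N" for \<sigma>
  proof -
    have c: "\<sigma> \<in> carrier (hamm_product A n)"
      using that by (auto simp: hamm_null_def)
    have le: "hamm_dist (n \<alpha>) ((inv\<^bsub>hamm_product A n\<^esub> \<sigma>) \<alpha>) id \<le> hamm_dist (n \<alpha>) (\<sigma> \<alpha>) id"
      if "\<alpha> \<in> A" for \<alpha>
      using hamm_dist_left [OF hamm_product_permutes [OF c that],
          of "n \<alpha>" "(inv\<^bsub>hamm_product A n\<^esub> \<sigma>) \<alpha>" id]
        hamm_product_inv [OF c that] by (simp add: hamm_dist_commute)
    have "((\<lambda>\<alpha>. hamm_dist (n \<alpha>) (\<sigma> \<alpha>) id) \<longlongrightarrow> 0) U"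
      using that by (auto simp: hamm_null_def)
    from hamm_tendsto_0_le [where \<tau> = "\<lambda>_. id", OF U this le]
    show ?thesis using c by (simp add: hamm_null_def)
  qed
  have conj: "\<rho> \<otimes>\<^bsub>hamm_product A n\<^esub> \<sigma> \<otimes>\<^bsub>hamm_product A n\<^esub> inv\<^bsub>hamm_product A n\<^esub> \<rho> \<in> ?N"
    if r: "\<rho> \<in> carrier (hamm_product A n)" and s: "\<sigma> \<in> ?N" for \<rho> \<sigma>
  proof -
    have c: "\<sigma> \<in> carrier (hamm_product A n)"
      using s by (auto simp: hamm_null_def)
    have le: "hamm_dist (n \<alpha>) ((\<rho> \<otimes>\<^bsub>hamm_product A n\<^esub> \<sigma> \<otimes>\<^bsub>hamm_product A n\<^esub>
        inv\<^bsub>hamm_product A n\<^esub> \<rho>) \<alpha>) id \<le> hamm_dist (n \<alpha>) (\<sigma> \<alpha>) id"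
      if "\<alpha> \<in> A" for \<alpha>
    proof -
      let ?i = "(inv\<^bsub>hamm_product A n\<^esub> \<rho>) \<alpha>"
      have i: "?i permutes {1..n \<alpha>}"
        using hamm_product_permutes [OF P.inv_closed [OF r] that] .
      have "hamm_dist (n \<alpha>) ((\<rho> \<alpha> \<circ> \<sigma> \<alpha>) \<circ> ?i) (\<rho> \<alpha> \<circ> ?i) = hamm_dist (n \<alpha>) (\<rho> \<alpha> \<circ> \<sigma> \<alpha>) (\<rho> \<alpha> \<circ> id)"
        using hamm_dist_right [OF i] by simp
      also have "\<dots> = hamm_dist (n \<alpha>) (\<sigma> \<alpha>) id"
        by (rule hamm_dist_left [OF hamm_product_permutes [OF r that]])
      finally show ?thesis
        using that hamm_product_inv [OF r that] by (simp add: hamm_product_mult)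
    qed
    have "((\<lambda>\<alpha>. hamm_dist (n \<alpha>) (\<sigma> \<alpha>) id) \<longlongrightarrow> 0) U"
      using s by (auto simp: hamm_null_def)
    from hamm_tendsto_0_le [where \<tau> = "\<lambda>_. id", OF U this le]
    show ?thesis using c r by (simp add: hamm_null_def)
  qed
  have one: "\<one>\<^bsub>hamm_product A n\<^esub> \<in> ?N"
  proof -
    have le: "hamm_dist (n \<alpha>) (\<one>\<^bsub>hamm_product A n\<^esub> \<alpha>) id \<le> 0" if "\<alpha> \<in> A" for \<alpha>
      using that by (simp add: hamm_product_one)
    from hamm_tendsto_0_le [where \<tau> = "\<lambda>_. id", OF U tendsto_const le]
    show ?thesis by (simp add: hamm_null_def)
  qed
  have "subgroup ?N (hamm_product A n)"
    by (rule P.subgroupI) (use one mult inv in \<open>auto simp: hamm_null_def\<close>)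
  then show ?thesis
    using conj by (simp add: P.normal_inv_iff)
qed

lemma hamm_coset_eq_iff:
  assumes U: "eventually (\<lambda>\<alpha>. \<alpha> \<in> A) U"
    and x: "x \<in> carrier (hamm_product A n)" and y: "y \<in> carrier (hamm_product A n)"
  shows "hamm_null A U n #>\<^bsub>hamm_product A n\<^esub> x = hamm_null A U n #>\<^bsub>hamm_product A n\<^esub> y \<longleftrightarrow>
         ((\<lambda>\<alpha>. hamm_dist (n \<alpha>) (x \<alpha>) (y \<alpha>)) \<longlongrightarrow> 0) U"
proof -
  interpret P: group "hamm_product A n" by (rule hamm_product_group)
  let ?N = "hamm_null A U n"
  let ?z = "x \<otimes>\<^bsub>hamm_product A n\<^esub> inv\<^bsub>hamm_product A n\<^esub> y"
  have N: "subgroup ?N (hamm_product A n)"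
    using hamm_null_normal [OF U] by (rule normal_imp_subgroup)
  have sub: "?N \<subseteq> carrier (hamm_product A n)"
    using N by (rule subgroup.subset)
  have z: "?z \<in> carrier (hamm_product A n)"
    using x y by simp
  have "?N #>\<^bsub>hamm_product A n\<^esub> x = ?N #>\<^bsub>hamm_product A n\<^esub> y \<longleftrightarrow> ?z \<in> ?N"
    using P.coset_mult_inv1 [OF _ x y sub] P.coset_mult_inv2 [OF _ x y sub]
      P.coset_join1 [OF _ z N] P.coset_join2 [OF z N] by blast
  also have "\<dots> \<longleftrightarrow> ((\<lambda>\<alpha>. hamm_dist (n \<alpha>) (?z \<alpha>) id) \<longlongrightarrow> 0) U"
    using z by (simp add: hamm_null_def)
  also have "\<dots> \<longleftrightarrow> ((\<lambda>\<alpha>. hamm_dist (n \<alpha>) (x \<alpha>) (y \<alpha>)) \<longlongrightarrow> 0) U"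
  proof (rule tendsto_cong, rule eventually_mono [OF U])
    fix \<alpha> assume a: "\<alpha> \<in> A"
    let ?i = "(inv\<^bsub>hamm_product A n\<^esub> y) \<alpha>"
    have i: "?i permutes {1..n \<alpha>}"
      using hamm_product_permutes [OF P.inv_closed [OF y] a] .
    show "hamm_dist (n \<alpha>) (?z \<alpha>) id = hamm_dist (n \<alpha>) (x \<alpha>) (y \<alpha>)"
      using hamm_dist_right [OF i, of "x \<alpha>" "y \<alpha>"] hamm_product_inv [OF y a] a
      by (simp add: hamm_product_mult)
  qed
  finally show ?thesis .
qed


section \<open>Independence of the index type\<close>

lemma ex_ultrafilter_on:
  fixes F :: "'i filter"
  assumes F: "F \<noteq> bot" and A: "eventually (\<lambda>\<alpha>. \<alpha> \<in> A) F"
  shows "\<exists>U. U \<le> F \<and> ultrafilter_on A U"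
proof -
  let ?X = "{G. G \<noteq> bot \<and> G \<le> F}"
  let ?R = "relation_of (\<lambda>a b. b \<le> a) ?X"
  have "\<exists>m\<in>?X. \<forall>a\<in>?X. a \<le> m \<longrightarrow> a = m"
  proof (rule predicate_Zorn)
    show "partial_order_on ?X ?R"
      by (auto simp: partial_order_on_def preorder_on_def refl_on_def trans_def antisym_def
          relation_of_def)
    fix C assume C: "C \<in> Chains ?R"
    show "\<exists>u\<in>?X. \<forall>a\<in>C. u \<le> a"
    proof (cases "C = {}")
      case True
      then show ?thesis using F by auto
    next
      case False
      then obtain c where c: "c \<in> C" by blast
      have CX: "G \<noteq> bot" "G \<le> F" if "G \<in> C" for G
        using C that by (auto simp: Chains_def relation_of_def)
      have "eventually (\<lambda>_. False) (Inf C) \<longleftrightarrow> (\<exists>b\<in>C. eventually (\<lambda>_. False) b)"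
      proof (rule eventually_Inf_base [OF False])
        fix G H assume "G \<in> C" "H \<in> C"
        then have "G \<le> H \<or> H \<le> G"
          using C by (auto simp: Chains_def relation_of_def)
        then show "\<exists>x\<in>C. x \<le> inf G H"
          using \<open>G \<in> C\<close> \<open>H \<in> C\<close> by auto
      qed
      then have "Inf C \<noteq> bot"
        using CX(1) by (simp add: trivial_limit_def)
      moreover have "Inf C \<le> F"
        using c CX(2) by (meson Inf_lower2)
      ultimately show ?thesis
        by (auto intro: Inf_lower)
    qed
  qed
  then obtain U where U: "U \<noteq> bot" "U \<le> F"
    and max: "\<And>G. G \<noteq> bot \<Longrightarrow> G \<le> F \<Longrightarrow> G \<le> U \<Longrightarrow> G = U" by blast
  have "eventually P U \<or> eventually (\<lambda>\<alpha>. \<not> P \<alpha>) U" for P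
  proof (cases "inf U (principal {\<alpha>. P \<alpha>}) = bot")
    case True
    then have "eventually (\<lambda>\<alpha>. \<not> P \<alpha>) U"
      by (simp add: trivial_limit_def eventually_inf_principal)
    then show ?thesis ..
  next
    case False
    then have "inf U (principal {\<alpha>. P \<alpha>}) = U"
      using U(2) by (intro max) (auto intro: le_infI1)
    moreover have "eventually P (inf U (principal {\<alpha>. P \<alpha>}))"
      by (simp add: eventually_inf_principal)
    ultimately show ?thesis by simp
  qed
  moreover have "eventually (\<lambda>\<alpha>. \<alpha> \<in> A) U"
    using A U(2) by (auto simp: le_filter_def)
  ultimately show ?thesis
    using U by (auto simp: ultrafilter_on_def)
qed

lemma embeds_in_hamm_ultraproductD:
  assumes G: "group G" and U: "eventually (\<lambda>\<alpha>. \<alpha> \<in> A) U"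
    and emb: "embeds_in_hamm_ultraproduct G A U n"
  obtains s where "\<And>g. g \<in> carrier G \<Longrightarrow> s g \<in> carrier (hamm_product A n)"
    and "\<And>g h. g \<in> carrier G \<Longrightarrow> h \<in> carrier G \<Longrightarrow>
      ((\<lambda>\<alpha>. hamm_dist (n \<alpha>) (s (g \<otimes>\<^bsub>G\<^esub> h) \<alpha>) (s g \<alpha> \<circ> s h \<alpha>)) \<longlongrightarrow> 0) U"
    and "\<And>g h. g \<in> carrier G \<Longrightarrow> h \<in> carrier G \<Longrightarrow> g \<noteq> h \<Longrightarrow>
      \<not> ((\<lambda>\<alpha>. hamm_dist (n \<alpha>) (s g \<alpha>) (s h \<alpha>)) \<longlongrightarrow> 0) U"
proof -
  interpret P: group "hamm_product A n" by (rule hamm_product_group)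
  interpret N: normal "hamm_null A U n" "hamm_product A n" by (rule hamm_null_normal [OF U])
  interpret G: group G by fact
  let ?c = "\<lambda>x. hamm_null A U n #>\<^bsub>hamm_product A n\<^esub> x"
  obtain H \<phi> where H: "subgroup H (hamm_ultraproduct A U n)"
    and \<phi>: "\<phi> \<in> iso G ((hamm_ultraproduct A U n)\<lparr>carrier := H\<rparr>)"
    using emb by (auto simp: embeds_in_hamm_ultraproduct_def is_iso_def)
  have inj: "inj_on \<phi> (carrier G)" and car: "\<And>g. g \<in> carrier G \<Longrightarrow> \<phi> g \<in> H"
    and mult: "\<And>g h. g \<in> carrier G \<Longrightarrow> h \<in> carrier G \<Longrightarrow>
      \<phi> (g \<otimes>\<^bsub>G\<^esub> h) = \<phi> g <#>\<^bsub>hamm_product A n\<^esub> \<phi> h"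
    using \<phi> by (auto simp: iso_def bij_betw_def hom_def hamm_ultraproduct_def)
  have "\<exists>x. x \<in> carrier (hamm_product A n) \<and> \<phi> g = ?c x" if "g \<in> carrier G" for g
    using car [OF that] subgroup.subset [OF H]
    by (auto simp: hamm_ultraproduct_def carrier_FactGroup)
  then obtain s where s: "\<And>g. g \<in> carrier G \<Longrightarrow> s g \<in> carrier (hamm_product A n)"
    and \<phi>s: "\<And>g. g \<in> carrier G \<Longrightarrow> \<phi> g = ?c (s g)" by metis
  show thesis
  proof (rule that [OF s])
    fix g h assume g: "g \<in> carrier G" and h: "h \<in> carrier G"
    have "?c (s (g \<otimes>\<^bsub>G\<^esub> h)) = ?c (s g \<otimes>\<^bsub>hamm_product A n\<^esub> s h)"
      using mult [OF g h] g h by (simp add: \<phi>s N.rcos_sum s)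
    then have "((\<lambda>\<alpha>. hamm_dist (n \<alpha>) (s (g \<otimes>\<^bsub>G\<^esub> h) \<alpha>) ((s g \<otimes>\<^bsub>hamm_product A n\<^esub> s h) \<alpha>)) \<longlongrightarrow> 0) U"
      using g h by (subst (asm) hamm_coset_eq_iff [OF U]) (auto simp: s)
    then show "((\<lambda>\<alpha>. hamm_dist (n \<alpha>) (s (g \<otimes>\<^bsub>G\<^esub> h) \<alpha>) (s g \<alpha> \<circ> s h \<alpha>)) \<longlongrightarrow> 0) U"
      by (rule iffD1 [OF tendsto_cong, rotated])
        (rule eventually_mono [OF U], simp add: hamm_product_mult)
  next
    fix g h assume g: "g \<in> carrier G" and h: "h \<in> carrier G" and "g \<noteq> h"
    then have "?c (s g) \<noteq> ?c (s h)"
      using inj by (simp add: \<phi>s [symmetric] inj_on_eq_iff)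
    then show "\<not> ((\<lambda>\<alpha>. hamm_dist (n \<alpha>) (s g \<alpha>) (s h \<alpha>)) \<longlongrightarrow> 0) U"
      using hamm_coset_eq_iff [OF U s [OF g] s [OF h]] by simp
  qed
qed

lemma embeds_in_hamm_ultraproductI:
  assumes G: "group G" and U: "eventually (\<lambda>\<alpha>. \<alpha> \<in> A) U"
    and s: "\<And>g. g \<in> carrier G \<Longrightarrow> s g \<in> carrier (hamm_product A n)"
    and mult: "\<And>g h. g \<in> carrier G \<Longrightarrow> h \<in> carrier G \<Longrightarrow>
      ((\<lambda>\<alpha>. hamm_dist (n \<alpha>) (s (g \<otimes>\<^bsub>G\<^esub> h) \<alpha>) (s g \<alpha> \<circ> s h \<alpha>)) \<longlongrightarrow> 0) U"
    and inj: "\<And>g h. g \<in> carrier G \<Longrightarrow> h \<in> carrier G \<Longrightarrow> g \<noteq> h \<Longrightarrow>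
      \<not> ((\<lambda>\<alpha>. hamm_dist (n \<alpha>) (s g \<alpha>) (s h \<alpha>)) \<longlongrightarrow> 0) U"
  shows "embeds_in_hamm_ultraproduct G A U n"
proof -
  interpret P: group "hamm_product A n" by (rule hamm_product_group)
  interpret N: normal "hamm_null A U n" "hamm_product A n" by (rule hamm_null_normal [OF U])
  interpret G: group G by fact
  interpret Q: group "hamm_ultraproduct A U n"
    unfolding hamm_ultraproduct_def by (rule N.factorgroup_is_group)
  let ?c = "\<lambda>x. hamm_null A U n #>\<^bsub>hamm_product A n\<^esub> x"
  have "?c (s (g \<otimes>\<^bsub>G\<^esub> h)) = ?c (s g) <#>\<^bsub>hamm_product A n\<^esub> ?c (s h)"
    if g: "g \<in> carrier G" and h: "h \<in> carrier G" for g h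
  proof -
    have "((\<lambda>\<alpha>. hamm_dist (n \<alpha>) (s (g \<otimes>\<^bsub>G\<^esub> h) \<alpha>) ((s g \<otimes>\<^bsub>hamm_product A n\<^esub> s h) \<alpha>)) \<longlongrightarrow> 0) U"
      using mult [OF g h]
      by (rule iffD1 [OF tendsto_cong, rotated])
        (rule eventually_mono [OF U], simp add: hamm_product_mult)
    then have "?c (s (g \<otimes>\<^bsub>G\<^esub> h)) = ?c (s g \<otimes>\<^bsub>hamm_product A n\<^esub> s h)"
      using g h by (subst hamm_coset_eq_iff [OF U]) (auto simp: s)
    then show ?thesis
      using g h by (simp add: N.rcos_sum s)
  qed
  then have hom: "(\<lambda>g. ?c (s g)) \<in> hom G (hamm_ultraproduct A U n)"
    by (auto simp: hom_def hamm_ultraproduct_def carrier_FactGroup s)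
  then interpret h: group_hom G "hamm_ultraproduct A U n" "\<lambda>g. ?c (s g)"
    by unfold_locales
  have "inj_on (\<lambda>g. ?c (s g)) (carrier G)"
    using inj by (auto simp: inj_on_def hamm_coset_eq_iff [OF U] s)
  then have "(\<lambda>g. ?c (s g)) \<in>
      iso G ((hamm_ultraproduct A U n)\<lparr>carrier := (\<lambda>g. ?c (s g)) ` carrier G\<rparr>)"
    using hom by (auto simp: iso_def bij_betw_def hom_def)
  then show ?thesis
    using h.img_is_subgroup unfolding embeds_in_hamm_ultraproduct_def is_iso_def by blast
qed

theorem soficI_any_index:
  fixes G :: "('g, 'b) monoid_scheme" and A :: "'i set"
  assumes G: "group G" and U: "ultrafilter_on A U" and n: "\<forall>\<alpha>\<in>A. n \<alpha> \<ge> 1"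
    and emb: "embeds_in_hamm_ultraproduct G A U n"
  shows "sofic G"
proof -
  have UA: "eventually (\<lambda>\<alpha>. \<alpha> \<in> A) U" and Ubot: "U \<noteq> bot"
    and ultra: "\<And>P. eventually P U \<or> eventually (\<lambda>\<alpha>. \<not> P \<alpha>) U"
    using U by (auto simp: ultrafilter_on_def)
  obtain s where s: "\<And>g. g \<in> carrier G \<Longrightarrow> s g \<in> carrier (hamm_product A n)"
    and mult: "\<And>g h. g \<in> carrier G \<Longrightarrow> h \<in> carrier G \<Longrightarrow>
      ((\<lambda>\<alpha>. hamm_dist (n \<alpha>) (s (g \<otimes>\<^bsub>G\<^esub> h) \<alpha>) (s g \<alpha> \<circ> s h \<alpha>)) \<longlongrightarrow> 0) U"
    and inj: "\<And>g h. g \<in> carrier G \<Longrightarrow> h \<in> carrier G \<Longrightarrow> g \<noteq> h \<Longrightarrow>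
      \<not> ((\<lambda>\<alpha>. hamm_dist (n \<alpha>) (s g \<alpha>) (s h \<alpha>)) \<longlongrightarrow> 0) U"
    using embeds_in_hamm_ultraproductD [OF G UA emb] by blast
  have "\<exists>\<delta>>0. eventually (\<lambda>\<alpha>. hamm_dist (n \<alpha>) (s g \<alpha>) (s h \<alpha>) \<ge> \<delta>) U"
    if gh: "g \<in> carrier G" "h \<in> carrier G" "g \<noteq> h" for g h
  proof -
    obtain e where "e > 0" "\<not> eventually (\<lambda>\<alpha>. dist (hamm_dist (n \<alpha>) (s g \<alpha>) (s h \<alpha>)) 0 < e) U"
      using inj [OF gh] by (auto simp: tendsto_iff)
    then show ?thesis
      using ultra [of "\<lambda>\<alpha>. dist (hamm_dist (n \<alpha>) (s g \<alpha>) (s h \<alpha>)) 0 < e"]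
      by (auto simp: hamm_dist_nonneg not_less intro!: exI [of _ e])
  qed
  then obtain \<delta> where \<delta>: "\<And>g h. g \<in> carrier G \<Longrightarrow> h \<in> carrier G \<Longrightarrow> g \<noteq> h \<Longrightarrow> \<delta> g h > (0 :: real)"
    and ev\<delta>: "\<And>g h. g \<in> carrier G \<Longrightarrow> h \<in> carrier G \<Longrightarrow> g \<noteq> h \<Longrightarrow>
      eventually (\<lambda>\<alpha>. hamm_dist (n \<alpha>) (s g \<alpha>) (s h \<alpha>) \<ge> \<delta> g h) U"
    by metis
  define B :: "('g set \<times> nat) set" where "B = {b. finite (fst b) \<and> fst b \<subseteq> carrier G}"
  define good where "good b \<alpha> \<longleftrightarrow> \<alpha> \<in> A \<and>
      (\<forall>g\<in>fst b. \<forall>h\<in>fst b.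
         hamm_dist (n \<alpha>) (s (g \<otimes>\<^bsub>G\<^esub> h) \<alpha>) (s g \<alpha> \<circ> s h \<alpha>) < inverse (real (Suc (snd b))) \<and>
         (g \<noteq> h \<longrightarrow> hamm_dist (n \<alpha>) (s g \<alpha>) (s h \<alpha>) \<ge> \<delta> g h))" for b :: "'g set \<times> nat" and \<alpha>
  have "\<exists>\<alpha>. good b \<alpha>" if "b \<in> B" for b
  proof -
    have fin: "finite (fst b)" and sub: "fst b \<subseteq> carrier G"
      using that by (auto simp: B_def)
    have "eventually (\<lambda>\<alpha>.
         hamm_dist (n \<alpha>) (s (g \<otimes>\<^bsub>G\<^esub> h) \<alpha>) (s g \<alpha> \<circ> s h \<alpha>) < inverse (real (Suc (snd b))) \<and>
         (g \<noteq> h \<longrightarrow> hamm_dist (n \<alpha>) (s g \<alpha>) (s h \<alpha>) \<ge> \<delta> g h)) U"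
      if "g \<in> fst b" "h \<in> fst b" for g h
    proof (rule eventually_conj)
      show "eventually (\<lambda>\<alpha>. hamm_dist (n \<alpha>) (s (g \<otimes>\<^bsub>G\<^esub> h) \<alpha>) (s g \<alpha> \<circ> s h \<alpha>)
          < inverse (real (Suc (snd b)))) U"
        using mult [of g h] that sub by (intro order_tendstoD(2)) auto
      show "eventually (\<lambda>\<alpha>. g \<noteq> h \<longrightarrow> hamm_dist (n \<alpha>) (s g \<alpha>) (s h \<alpha>) \<ge> \<delta> g h) U"
        using ev\<delta> [of g h] that sub by (cases "g = h") auto
    qed
    then have "eventually (good b) U"
      unfolding good_def using UA fin
      by (simp add: eventually_conj_iff eventually_ball_finite_distrib)
    then show ?thesis
      using eventually_happens' [OF Ubot] by blast
  qed
  then obtain a where a: "\<And>b. b \<in> B \<Longrightarrow> good b (a b)" by metis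
  define m where "m b = n (a b)" for b
  define t where "t g = (\<lambda>b\<in>B. s g (a b))" for g
  let ?F = "finite_subsets_at_top (carrier G) \<times>\<^sub>F (sequentially :: nat filter)"
  have large: "eventually (\<lambda>b. b \<in> B \<and> F \<subseteq> fst b \<and> k \<le> snd b) ?F"
    if "finite F" "F \<subseteq> carrier G" for F k
    unfolding eventually_prod_filter
    by (rule exI [of _ "\<lambda>X. finite X \<and> F \<subseteq> X \<and> X \<subseteq> carrier G"], rule exI [of _ "\<lambda>j. k \<le> j"])
      (use that in \<open>auto simp: B_def eventually_finite_subsets_at_top\<close>)
  have "?F \<noteq> bot"
    by (simp add: prod_filter_eq_bot)
  moreover have "eventually (\<lambda>b. b \<in> B) ?F"
    using large [of "{}" 0] by (auto elim: eventually_mono)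
  ultimately obtain V where VF: "V \<le> ?F" and V: "ultrafilter_on B V"
    using ex_ultrafilter_on by blast
  have VB: "eventually (\<lambda>b. b \<in> B) V" and Vbot: "V \<noteq> bot"
    using V by (auto simp: ultrafilter_on_def)
  have largeV: "eventually (\<lambda>b. b \<in> B \<and> F \<subseteq> fst b \<and> k \<le> snd b) V"
    if "finite F" "F \<subseteq> carrier G" for F k
    using large [OF that] VF by (auto simp: le_filter_def)
  have "embeds_in_hamm_ultraproduct G B V m"
  proof (rule embeds_in_hamm_ultraproductI [OF G VB])
    show "t g \<in> carrier (hamm_product B m)" if "g \<in> carrier G" for g
      using s [OF that] a by (auto simp: hamm_product_carrier t_def m_def good_def)
  next
    fix g h assume g: "g \<in> carrier G" and h: "h \<in> carrier G"
    show "((\<lambda>b. hamm_dist (m b) (t (g \<otimes>\<^bsub>G\<^esub> h) b) (t g b \<circ> t h b)) \<longlongrightarrow> 0) V"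
    proof (rule tendstoI)
      fix e :: real assume "e > 0"
      then obtain k where k: "inverse (real (Suc k)) < e"
        using reals_Archimedean by blast
      show "eventually (\<lambda>b. dist (hamm_dist (m b) (t (g \<otimes>\<^bsub>G\<^esub> h) b) (t g b \<circ> t h b)) 0 < e) V"
      proof (rule eventually_mono [OF largeV [of "{g, h}" k]])
        fix b assume b: "b \<in> B \<and> {g, h} \<subseteq> fst b \<and> k \<le> snd b"
        then have "hamm_dist (n (a b)) (s (g \<otimes>\<^bsub>G\<^esub> h) (a b)) (s g (a b) \<circ> s h (a b))
            < inverse (real (Suc (snd b)))"
          using a [of b] by (auto simp: good_def)
        also have "\<dots> \<le> inverse (real (Suc k))"
          using b by (intro le_imp_inverse_le) auto
        finally show "dist (hamm_dist (m b) (t (g \<otimes>\<^bsub>G\<^esub> h) b) (t g b \<circ> t h b)) 0 < e"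
          using k b by (simp add: t_def m_def hamm_dist_nonneg)
      qed (use g h in auto)
    qed
  next
    fix g h assume g: "g \<in> carrier G" and h: "h \<in> carrier G" and ne: "g \<noteq> h"
    show "\<not> ((\<lambda>b. hamm_dist (m b) (t g b) (t h b)) \<longlongrightarrow> 0) V"
    proof
      assume "((\<lambda>b. hamm_dist (m b) (t g b) (t h b)) \<longlongrightarrow> 0) V"
      then have "eventually (\<lambda>b. hamm_dist (m b) (t g b) (t h b) < \<delta> g h) V"
        using \<delta> [OF g h ne] by (rule order_tendstoD(2))
      moreover have "eventually (\<lambda>b. hamm_dist (m b) (t g b) (t h b) \<ge> \<delta> g h) V"
      proof (rule eventually_mono [OF largeV [of "{g, h}" 0]])
        fix b assume "b \<in> B \<and> {g, h} \<subseteq> fst b \<and> 0 \<le> snd b"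
        then show "hamm_dist (m b) (t g b) (t h b) \<ge> \<delta> g h"
          using a [of b] ne by (auto simp: good_def t_def m_def)
      qed (use g h in auto)
      ultimately have "eventually (\<lambda>_. False) V"
        by eventually_elim simp
      then show False
        using Vbot by (simp add: trivial_limit_def)
    qed
  qed
  moreover have "\<forall>b\<in>B. m b \<ge> 1"
    using a n by (auto simp: m_def good_def)
  ultimately show ?thesis
    using G V unfolding sofic_def by blast
qed

end

theory Submission
  imports Defs "HOL-Algebra.Weak_Morphisms"
begin

text \<open>
  If \<open>G\<close> is non-sofic then so is every group containing a copy of \<open>G\<close>, in particular each
  subgroup \<open>G \<times> 2\<^sup>i\<int>\<close> of \<open>G \<times> \<int>\<close>. To stay inside the element type of \<open>G\<close>, the product is
  transported along a bijection; the type is infinite because finite groups are sofic by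
  Cayley's theorem.
\<close>

text \<open>Precomposing the approximate representation \<open>s\<close> of \<open>K\<close> with
  \<open>f\<close> gives one of \<open>G\<close>: products go to products because \<open>f\<close>
  is a homomorphism, and distinct elements stay separated because \<open>f\<close> is injective. The
  index set still consists of pairs over the element type of \<open>K\<close>, so
  \<open>soficI_any_index\<close> is needed to move it to the element type of
  \<open>G\<close>.\<close>

lemma sofic_inj_hom:
  fixes K :: "('k, 'b) monoid_scheme"
  assumes K: "sofic K" and G: "group G" and f: "f \<in> hom G K" and inj: "inj_on f (carrier G)"
  shows "sofic G"
proof -
  from K obtain A :: "('k set \<times> nat) set" and U n
    where "group K" and U: "ultrafilter_on A U" and n: "\<forall>\<alpha>\<in>A. n \<alpha> \<ge> 1"
    and emb: "embeds_in_hamm_ultraproduct K A U n"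
    unfolding sofic_def by blast
  have UA: "eventually (\<lambda>\<alpha>. \<alpha> \<in> A) U"
    using U by (simp add: ultrafilter_on_def)
  obtain s where s: "\<And>g. g \<in> carrier K \<Longrightarrow> s g \<in> carrier (hamm_product A n)"
    and mult: "\<And>g h. g \<in> carrier K \<Longrightarrow> h \<in> carrier K \<Longrightarrow>
      ((\<lambda>\<alpha>. hamm_dist (n \<alpha>) (s (g \<otimes>\<^bsub>K\<^esub> h) \<alpha>) (s g \<alpha> \<circ> s h \<alpha>)) \<longlongrightarrow> 0) U"
    and sep: "\<And>g h. g \<in> carrier K \<Longrightarrow> h \<in> carrier K \<Longrightarrow> g \<noteq> h \<Longrightarrow>
      \<not> ((\<lambda>\<alpha>. hamm_dist (n \<alpha>) (s g \<alpha>) (s h \<alpha>)) \<longlongrightarrow> 0) U"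
    using embeds_in_hamm_ultraproductD [OF \<open>group K\<close> UA emb] by blast
  have fK: "f g \<in> carrier K" if "g \<in> carrier G" for g
    using f that by (rule hom_in_carrier)
  have "embeds_in_hamm_ultraproduct G A U n"
  proof (rule embeds_in_hamm_ultraproductI [OF G UA, of "\<lambda>g. s (f g)"])
    fix g h assume "g \<in> carrier G" "h \<in> carrier G"
    then show "((\<lambda>\<alpha>. hamm_dist (n \<alpha>) (s (f (g \<otimes>\<^bsub>G\<^esub> h)) \<alpha>) (s (f g) \<alpha> \<circ> s (f h) \<alpha>)) \<longlongrightarrow> 0) U"
      using mult fK by (simp add: hom_mult [OF f])
  next
    fix g h assume "g \<in> carrier G" "h \<in> carrier G" "g \<noteq> h"
    then show "\<not> ((\<lambda>\<alpha>. hamm_dist (n \<alpha>) (s (f g) \<alpha>) (s (f h) \<alpha>)) \<longlongrightarrow> 0) U"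
      using sep fK inj by (simp add: inj_on_eq_iff)
  qed (simp add: s fK)
  then show ?thesis
    using soficI_any_index [OF G U n] by blast
qed

text \<open>The left regular action is free: translations by distinct elements disagree at every
  point, hence lie at Hamming distance 1. A single symmetric group therefore suffices.\<close>

lemma finite_imp_sofic:
  assumes G: "group G" and fin: "finite (carrier G)"
  shows "sofic G"
proof -
  interpret group G by fact
  define N where "N = card (carrier G)"
  have N: "N \<ge> 1"
    using fin by (simp add: N_def Suc_le_eq card_gt_0_iff) (use one_closed in blast)
  define I where "I = {1..N}"
  obtain e where e: "bij_betw e (carrier G) I"
    using fin by (metis I_def N_def finite_same_card_bij card_atLeastAtMost diff_Suc_1 finite_atLeastAtMost)
  define d where "d = inv_into (carrier G) e"
  have d: "d i \<in> carrier G" "e (d i) = i" if "i \<in> I" for i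
    using e that by (auto simp: d_def bij_betw_def inv_into_into f_inv_into_f)
  have eN: "e x \<in> I" "d (e x) = x" if "x \<in> carrier G" for x
    using bij_betwE [OF e] e that by (auto simp: d_def bij_betw_def)
  \<comment> \<open>Left multiplication by \<open>g\<close>, carried over to \<open>I\<close> by the
    numbering \<open>e\<close>. The identity outside \<open>I\<close> is what
    \<open>permutes\<close> requires, and it also makes \<open>p_mult\<close> and
    \<open>p_one\<close> hold as equations of functions on all of \<open>nat\<close>.\<close>
  define p where "p g i = (if i \<in> I then e (g \<otimes>\<^bsub>G\<^esub> d i) else i)" for g i
  have p_mult: "p (g \<otimes>\<^bsub>G\<^esub> h) = p g \<circ> p h" if "g \<in> carrier G" "h \<in> carrier G" for g h
    using that by (auto simp: p_def fun_eq_iff d eN m_assoc)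
  have p_one: "p \<one>\<^bsub>G\<^esub> = id"
    by (auto simp: p_def fun_eq_iff d)
  have p_permutes: "p g permutes I" if "g \<in> carrier G" for g
  proof (rule inj_imp_permutes)
    have "p (inv\<^bsub>G\<^esub> g) \<circ> p g = id"
      using p_mult [of "inv\<^bsub>G\<^esub> g" g] that by (simp add: p_one)
    then have "inj (p g)"
      by (metis inj_on_id inj_on_imageI2)
    then show "inj_on (p g) I"
      by (rule inj_on_subset) simp
  next
    show "finite I"
      by (simp add: I_def)
  qed (use that in \<open>auto simp: p_def d eN\<close>)
  have p_ne: "p g i \<noteq> p h i"
    if "g \<in> carrier G" "h \<in> carrier G" "g \<noteq> h" "i \<in> I" for g h i
  proof
    assume "p g i = p h i"
    then have "g \<otimes>\<^bsub>G\<^esub> d i = h \<otimes>\<^bsub>G\<^esub> d i"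
      using that d by (metis p_def eN(2) m_closed)
    then show False
      using that d by simp
  qed
  \<comment> \<open>Over a one-point index set the limit of a family is its only value, so
    separation reduces to a nonzero distance.\<close>
  have U: "ultrafilter_on UNIV (principal {()})"
    by (simp add: ultrafilter_on_def eventually_principal principal_eq_bot_iff)
  have "embeds_in_hamm_ultraproduct G UNIV (principal {()}) (\<lambda>_. N)"
  proof (rule embeds_in_hamm_ultraproductI [OF G _, of _ _ "\<lambda>g _. p g"])
    fix g h assume "g \<in> carrier G" "h \<in> carrier G" "g \<noteq> h"
    then have "{i \<in> {1..N}. p g i \<noteq> p h i} = {1..N}"
      using p_ne by (auto simp: I_def)
    then have "hamm_dist N (p g) (p h) = 1"
      using N by (simp add: hamm_dist_def)
    then show "\<not> ((\<lambda>\<alpha>. hamm_dist N (p g) (p h)) \<longlongrightarrow> 0) (principal {()})"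
      by (simp add: tendsto_const_iff principal_eq_bot_iff)
  qed (use p_permutes p_mult in \<open>auto simp: hamm_product_carrier I_def\<close>)
  then show ?thesis
    using soficI_any_index [OF G U, of "\<lambda>_. N"] N by simp
qed

lemma non_sofic_imp_infinite: "non_sofic G \<Longrightarrow> infinite (carrier G)"
  using finite_imp_sofic by (auto simp: non_sofic_def)

lemma non_sofic_inj_hom:
  assumes "non_sofic G" "group K" "f \<in> hom G K" "inj_on f (carrier G)"
  shows "non_sofic K"
  using assms sofic_inj_hom unfolding non_sofic_def by blast

lemma subgroup_int_multiples: "subgroup {k. m dvd k} integer_group"
proof (rule group.subgroupI [OF group_integer_group])
  show "{k. m dvd k} \<noteq> {}"
    using dvd_0_right by blast
qed simp_all

text \<open>Cardinal arithmetic: \<open>int\<close> is countable, so it injects into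
  \<open>'a\<close> through \<open>nat\<close>, and an infinite cardinal absorbs a nonempty factor
  that is no larger.\<close>

lemma ex_inj_Times_int:
  assumes "infinite (UNIV :: 'a set)"
  shows "\<exists>f :: 'a \<times> int \<Rightarrow> 'a. inj f"
proof -
  obtain g :: "nat \<Rightarrow> 'a" where "inj g"
    using assms infinite_countable_subset by blast
  then have "inj (\<lambda>k :: int. g (to_nat k))"
    by (metis injD injI inj_to_nat)
  then have "(card_of (UNIV :: int set), card_of (UNIV :: 'a set)) \<in> ordLeq"
    by (intro iffD1 [OF card_of_ordLeq] exI conjI) simp_all
  then have "(card_of ((UNIV :: 'a set) \<times> (UNIV :: int set)), card_of (UNIV :: 'a set)) \<in> ordIso"
    using assms by (intro card_of_Times_infinite_simps) auto
  then obtain f :: "'a \<times> int \<Rightarrow> 'a" where "bij_betw f UNIV UNIV"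
    unfolding card_of_ordIso [symmetric] UNIV_Times_UNIV ..
  then show ?thesis
    using bij_is_inj by blast
qed

text \<open>Transport of structure: \<open>image_group\<close> makes the injection \<open>f\<close>
  an isomorphism onto its image, so the element type \<open>'c\<close> can be chosen freely.\<close>

lemma omega_non_sofic_image_Times_int:
  fixes G :: "('a, 'b) monoid_scheme" and f :: "'a \<times> int \<Rightarrow> 'c"
  assumes G: "non_sofic G" and "inj f"
  shows "omega_non_sofic (image_group f (G \<times>\<times> integer_group))"
proof -
  let ?P = "G \<times>\<times> integer_group"
  define K where "K = image_group f ?P"
  have inj: "inj_on f S" for S
    using \<open>inj f\<close> by (rule inj_on_subset) simp
  interpret G: group G
    using G by (simp add: non_sofic_def)
  interpret P: group ?P
    by (simp add: DirProd_group G.group_axioms)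
  have "f \<in> iso ?P K"
    unfolding K_def by (intro inj_imp_image_group_iso inj)
  then have f: "f \<in> hom ?P K"
    by (simp add: iso_def)
  interpret K: group K
    unfolding K_def by (intro P.inj_imp_image_group_is_group inj)
  interpret f: group_hom ?P K f
    using f by unfold_locales
  define H where "H i = f ` (carrier G \<times> {k. 2 ^ i dvd k})" for i :: nat
  have H: "subgroup (H i) K" for i
    unfolding H_def
    by (intro f.subgroup_img_is_subgroup DirProd_subgroups subgroup_int_multiples
        G.subgroup_self G.group_axioms group_integer_group)
  \<comment> \<open>The slice at 0 embeds \<open>G\<close> into \<open>K\<close> and into every
    \<open>H i\<close> at once, since 0 is divisible by every power of 2.\<close>
  have hom: "(\<lambda>g. f (g, 0)) \<in> hom G K"
  proof (rule homI)
    show "f (g, 0) \<in> carrier K" if "g \<in> carrier G" for g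
      using f.hom_closed [of "(g, 0)"] that by simp
    show "f (g \<otimes>\<^bsub>G\<^esub> h, 0) = f (g, 0) \<otimes>\<^bsub>K\<^esub> f (h, 0)"
      if "g \<in> carrier G" "h \<in> carrier G" for g h
      using f.hom_mult [of "(g, 0)" "(h, 0)"] that by simp
  qed
  have inj0: "inj_on (\<lambda>g. f (g, 0)) (carrier G)"
    using \<open>inj f\<close> by (simp add: inj_def inj_on_def)
  have "non_sofic K"
    using G K.group_axioms hom inj0 by (rule non_sofic_inj_hom)
  moreover have "non_sofic (K\<lparr>carrier := H i\<rparr>)" for i
  proof (rule non_sofic_inj_hom [OF G _ _ inj0])
    show "group (K\<lparr>carrier := H i\<rparr>)"
      by (rule K.subgroup_imp_group [OF H])
    show "(\<lambda>g. f (g, 0)) \<in> hom G (K\<lparr>carrier := H i\<rparr>)"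
      using hom by (auto simp: hom_def H_def)
  qed
  moreover have "H (Suc i) \<subset> H i" for i
  proof -
    have "{k :: int. 2 ^ Suc i dvd k} \<subset> {k. 2 ^ i dvd k}"
    proof
      show "{k :: int. 2 ^ Suc i dvd k} \<subseteq> {k. 2 ^ i dvd k}"
        by (auto intro: dvd_trans [OF le_imp_power_dvd])
      \<comment> \<open>\<open>2 ^ i\<close> itself witnesses strictness.\<close>
      have "(2 :: int) ^ i \<notin> {k. 2 ^ Suc i dvd k}"
        by (simp add: dvd_power_iff)
      moreover have "(2 :: int) ^ i \<in> {k. 2 ^ i dvd k}"
        by simp
      ultimately show "{k :: int. 2 ^ Suc i dvd k} \<noteq> {k. 2 ^ i dvd k}"
        by metis
    qed
    then have "carrier G \<times> {k :: int. 2 ^ Suc i dvd k} \<subset> carrier G \<times> {k. 2 ^ i dvd k}"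
      \<comment> \<open>Strictness survives the product because \<open>carrier G\<close> is
        nonempty, and then the image under \<open>f\<close> by injectivity.\<close>
      using G.one_closed by blast
    then show ?thesis
      unfolding H_def using inj by (rule image_strict_mono [rotated])
  qed
  ultimately show ?thesis
    using H unfolding omega_non_sofic_def K_def by blast
qed

theorem theorem3p5:
  assumes "\<exists>G :: 'a monoid. non_sofic G"
  shows "\<exists>G :: 'a monoid. omega_non_sofic G"
proof -
  from assms obtain G :: "'a monoid" where G: "non_sofic G" ..
  \<comment> \<open>The premise and the conclusion share the type \<open>'a\<close>, so
    \<open>'a\<close> must have room for the product with the integers.\<close>
  have "infinite (UNIV :: 'a set)"
    using subset_UNIV non_sofic_imp_infinite [OF G] by (rule infinite_super)
  then obtain f :: "'a \<times> int \<Rightarrow> 'a" where "inj f"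
    using ex_inj_Times_int by blast
  then show ?thesis
    using omega_non_sofic_image_Times_int [OF G] by blast
qed

end
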